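(* Let $(\Omega,\mathcal F,\mathbb P)$ be a probability space, let $(A_n)_{n\ge1}$ be a sequence of independent events, and let $(E_n)_{n\ge1}$ be a sequence of events such that, for each index $n$, the event $E_n$ is independent of the event $A_n$. Assume $\mathbb P(E_n)\to0$ as $n\to\infty$. Set $B_n=A_n\setminus E_n$. Then: 1) If $\sum_{n}\mathbb P(B_n)<\infty$, then $\sum_n 1_{A_n}<\infty$ almost surely. 2) If $\sum_n\mathbb P(A_n)=\infty$, then $\sum_n 1_{B_n}=\infty$ almost surely.
   Context: $1_A$ denotes the zero-one indicator random variable of the event $A$. The events $A_n$, $n\ge 1$, are (mutually) independent as a sequence; $E_n$ is only assumed independent of $A_n$ with the same index $n$, and no other independence involving the events $E_n$ is assumed. *)

theory Defs
  imports "HOL-Probability.Probability"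
begin

end

theory Submission
  imports Defs
begin

text \<open>
  Write \<open>p k = P (A k)\<close>, \<open>m n = (\<Sum>k<n. p k)\<close>, and let \<open>N n\<close>, \<open>R n\<close> be the number of indices
  \<open>k < n\<close> for which \<open>A k\<close>, respectively \<open>A k \<inter> E k\<close>, occurs.

  For the convergent half, \<open>P (B n) = p n * (1 - P (E n))\<close> and the second factor tends to \<open>1\<close>, so
  that \<open>p n \<le> 2 * P (B n)\<close> for large \<open>n\<close>; the series of the \<open>p n\<close> converges and the
  first Borel--Cantelli lemma applies to the events \<open>A n\<close>.

  For the divergent half the Borel--Cantelli lemma is not available for the events \<open>B n\<close>, which
  may depend on each other arbitrarily through the \<open>E n\<close>. What replaces it is a comparison of
  magnitudes. The number of \<open>B k\<close> with \<open>k < n\<close> is exactly \<open>N n - R n\<close>. By independence the variance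
  of \<open>N n\<close> is at most its mean \<open>m n\<close>, hence \<open>N n\<close> exceeds \<open>m n / 2\<close> with probability close to \<open>1\<close>
  (\<open>centred_count_second_moment\<close>). The mean of \<open>R n\<close> is \<open>\<Sum>k<n. p k * P (E k)\<close>, a weighted sum of a
  null sequence, hence \<open>o(m n)\<close> (\<open>weighted_average_null_sequence\<close>), and so \<open>R n\<close> stays below
  \<open>m n / 4\<close> with probability close to \<open>1\<close>; expectations add up whatever
  the dependence between the \<open>E k\<close>. Thus \<open>N n - R n\<close> exceeds any fixed bound with
  probability tending to \<open>1\<close> (\<open>AE_infinitely_often_Diff\<close>).
\<close>

section \<open>Series of nonnegative terms\<close>

lemma sum_filterlim_at_top_if_not_summable:
  fixes p :: "nat \<Rightarrow> real"
  assumes nonneg: "\<And>k. 0 \<le> p k" and div: "\<not> summable p"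
  shows "filterlim (\<lambda>n. \<Sum>k<n. p k) at_top sequentially"
  unfolding filterlim_at_top
proof
  fix Z :: real
  obtain n where n: "Z < (\<Sum>k<n. p k)"
    using summableI_nonneg_bounded[of p Z] nonneg div by (meson not_le)
  have "Z \<le> (\<Sum>k<n'. p k)" if "n' \<ge> n" for n'
  proof -
    have "(\<Sum>k<n. p k) \<le> (\<Sum>k<n'. p k)"
      using that nonneg by (intro sum_mono2) auto
    then show ?thesis using n by simp
  qed
  then show "\<forall>\<^sub>F n in sequentially. Z \<le> (\<Sum>k<n. p k)"
    by (auto simp: eventually_sequentially)
qed

text \<open>
  Only finitely many \<open>e k\<close> exceed a given \<open>d > 0\<close>; their contribution is a constant, which is
  negligible against the diverging total weight, and the remaining average is at most \<open>d\<close>.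
\<close>

lemma weighted_average_null_sequence:
  fixes p e :: "nat \<Rightarrow> real"
  assumes p: "\<And>k. 0 \<le> p k" and e: "\<And>k. 0 \<le> e k"
    and div: "filterlim (\<lambda>n. \<Sum>k<n. p k) at_top sequentially"
    and lim: "e \<longlonglongrightarrow> 0"
  shows "(\<lambda>n. (\<Sum>k<n. p k * e k) / (\<Sum>k<n. p k)) \<longlonglongrightarrow> 0"
proof (rule order_tendstoI)
  fix a :: real assume "a < 0"
  moreover have "0 \<le> (\<Sum>k<n. p k * e k) / (\<Sum>k<n. p k)" for n
    using p e by (intro divide_nonneg_nonneg sum_nonneg mult_nonneg_nonneg) auto
  ultimately show "\<forall>\<^sub>F n in sequentially. a < (\<Sum>k<n. p k * e k) / (\<Sum>k<n. p k)"
    by (intro always_eventually allI) (meson less_le_trans)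
next
  fix d :: real assume d: "0 < d"
  have "\<forall>\<^sub>F k in sequentially. e k < d / 2"
    using d by (intro order_tendstoD(2)[OF lim]) simp
  then obtain K where K: "\<And>k. k \<ge> K \<Longrightarrow> e k < d / 2"
    by (auto simp: eventually_sequentially)
  define C where "C = (\<Sum>k<K. p k * e k)"
  have bound: "(\<Sum>k<n. p k * e k) \<le> C + d / 2 * (\<Sum>k<n. p k)" for n
  proof -
    have "(\<Sum>k<n. p k * e k) \<le> (\<Sum>k<n. (if k < K then p k * e k else 0) + d / 2 * p k)"
    proof (rule sum_mono)
      fix k
      show "p k * e k \<le> (if k < K then p k * e k else 0) + d / 2 * p k"
        using mult_left_mono[of "e k" "d / 2" "p k"] K[of k] p[of k] d by (auto simp: mult.commute)
    qed
    also have "\<dots> = (\<Sum>k | k < n \<and> k < K. p k * e k) + d / 2 * (\<Sum>k<n. p k)"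
      by (simp add: sum.distrib sum_distrib_left sum.If_cases Int_def)
    also have "(\<Sum>k | k < n \<and> k < K. p k * e k) \<le> C"
      unfolding C_def using p e by (intro sum_mono2) auto
    finally show ?thesis by simp
  qed
  have "\<forall>\<^sub>F n in sequentially. max 1 (2 * C / d + 1) \<le> (\<Sum>k<n. p k)"
    using div unfolding filterlim_at_top by blast
  then show "\<forall>\<^sub>F n in sequentially. (\<Sum>k<n. p k * e k) / (\<Sum>k<n. p k) < d"
  proof eventually_elim
    case (elim n)
    then have pos: "0 < (\<Sum>k<n. p k)" and "2 * C / d < (\<Sum>k<n. p k)" by auto
    then have "C < d / 2 * (\<Sum>k<n. p k)"
      using d by (simp add: field_simps)
    then have "(\<Sum>k<n. p k * e k) < d * (\<Sum>k<n. p k)"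
      using bound[of n] by (simp add: field_simps)
    then show ?case using pos by (simp add: field_simps)
  qed
qed

lemma suminf_indicator_less_top:
  assumes "\<forall>\<^sub>F n in sequentially. x \<notin> S n"
  shows "(\<Sum>n. indicator (S n) x :: ennreal) < \<infinity>"
proof -
  obtain N where N: "\<And>n. n \<ge> N \<Longrightarrow> x \<notin> S n"
    using assms by (auto simp: eventually_sequentially)
  have "(\<Sum>n. indicator (S n) x :: ennreal) = (\<Sum>n<N. indicator (S n) x)"
    using N by (intro suminf_finite) (auto simp: indicator_def not_le)
  also have "\<dots> < \<infinity>"
    by (simp add: indicator_def of_nat_less_top)
  finally show ?thesis .
qed

lemma suminf_indicator_eq_top:
  assumes "\<And>K::nat. \<exists>n. real K < (\<Sum>k<n. indicator (S k) x)"
  shows "(\<Sum>n. indicator (S n) x :: ennreal) = \<infinity>"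
proof (rule ccontr)
  assume "(\<Sum>n. indicator (S n) x :: ennreal) \<noteq> \<infinity>"
  then have "(\<Sum>n. ennreal (indicator (S n) x)) \<noteq> top"
    by (simp add: ennreal_indicator)
  then have summ: "summable (\<lambda>n. indicator (S n) x :: real)"
    by (intro summable_suminf_not_top) auto
  obtain K :: nat where K: "(\<Sum>n. indicator (S n) x :: real) \<le> K"
    using real_arch_simple by blast
  obtain n where "real K < (\<Sum>k<n. indicator (S k) x)"
    using assms by blast
  moreover have "(\<Sum>k<n. indicator (S k) x) \<le> (\<Sum>n. indicator (S n) x :: real)"
    using summ by (intro sum_le_suminf) auto
  ultimately show False using K by simp
qed

section \<open>Counting occurrences of events\<close>

context prob_space
begin

lemma indep_event_prob_Int:
  assumes "indep_event A B"
  shows "prob (A \<inter> B) = prob A * prob B"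
proof -
  have "prob (\<Inter>j\<in>UNIV. case_bool A B j) = (\<Prod>j\<in>UNIV. prob (case_bool A B j))"
    using assms unfolding indep_event_def indep_events_def by (metis UNIV_not_empty finite subset_UNIV)
  then show ?thesis
    by (simp add: UNIV_bool Int_commute mult.commute)
qed

text \<open>
  The centred indicators are pairwise orthogonal, so only the diagonal terms of the square
  contribute, and the one with index \<open>k\<close> has expectation \<open>p * (1 - p) \<le> p\<close> for \<open>p = prob (A k)\<close>.
\<close>

lemma centred_count_second_moment:
  fixes A :: "nat \<Rightarrow> 'a set"
  assumes [measurable]: "\<And>k. A k \<in> events"
    and indep: "\<And>i j. i \<noteq> j \<Longrightarrow> prob (A i \<inter> A j) = prob (A i) * prob (A j)"
  shows "expectation (\<lambda>x. (\<Sum>k<n. indicator (A k) x - prob (A k))\<^sup>2) \<le> (\<Sum>k<n. prob (A k))"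
proof -
  define X where "X k x = indicator (A k) x - prob (A k)" for k x
  have XX: "X i x * X j x = indicator (A i \<inter> A j) x - prob (A i) * indicator (A j) x
      - prob (A j) * indicator (A i) x + prob (A i) * prob (A j)" for i j x
    by (simp add: X_def indicator_inter_arith algebra_simps)
  have int: "integrable M (\<lambda>x. X i x * X j x)" for i j
    unfolding XX by (auto intro!: integrable_real_indicator simp: emeasure_eq_measure)
  have E: "expectation (\<lambda>x. X i x * X j x) = prob (A i \<inter> A j) - prob (A i) * prob (A j)" for i j
    unfolding XX by (simp add: prob_space emeasure_eq_measure)
  have "expectation (\<lambda>x. (\<Sum>k<n. X k x)\<^sup>2) = expectation (\<lambda>x. \<Sum>i<n. \<Sum>j<n. X i x * X j x)"
    by (simp add: power2_eq_square sum_product)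
  also have "\<dots> = (\<Sum>i<n. \<Sum>j<n. prob (A i \<inter> A j) - prob (A i) * prob (A j))"
    using int by (simp add: E)
  also have "\<dots> = (\<Sum>i<n. \<Sum>j<n. if j = i then prob (A i) - prob (A i) * prob (A i) else 0)"
    using indep by (intro sum.cong refl) auto
  also have "\<dots> = (\<Sum>i<n. prob (A i) - prob (A i) * prob (A i))"
    by (intro sum.cong refl) simp
  also have "\<dots> \<le> (\<Sum>i<n. prob (A i))"
    by (intro sum_mono) simp
  finally show ?thesis unfolding X_def .
qed

text \<open>
  Let \<open>N\<close> and \<open>R\<close> count the occurrences of the \<open>A k\<close> and of the \<open>A k \<inter> E k\<close>. If the count
  \<open>N - R\<close> of the \<open>A k - E k\<close> is at most \<open>K \<le> m / 4\<close>, then \<open>N \<le> m / 2\<close> or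
  \<open>R \<ge> m / 4\<close>. Either of these makes \<open>4 * ((N - m) / m)\<^sup>2 + 4 * R / m\<close> at least \<open>1\<close>, so Markov's
  inequality for this one random variable covers both deviations.
\<close>

lemma prob_count_Diff_le:
  fixes A E :: "nat \<Rightarrow> 'a set"
  assumes [measurable]: "\<And>k. A k \<in> events" "\<And>k. E k \<in> events"
    and indep: "\<And>i j. i \<noteq> j \<Longrightarrow> prob (A i \<inter> A j) = prob (A i) * prob (A j)"
    and m: "m = (\<Sum>k<n. prob (A k))" "0 < m" "4 * K \<le> m"
  shows "prob {x \<in> space M. (\<Sum>k<n. indicator (A k - E k) x) \<le> K}
    \<le> 4 / m + 4 * ((\<Sum>k<n. prob (A k \<inter> E k)) / m)"
proof -
  define N R :: "'a \<Rightarrow> real"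
    where "N x = (\<Sum>k<n. indicator (A k) x)" and "R x = (\<Sum>k<n. indicator (A k \<inter> E k) x)" for x
  define u where "u x = 4 / m\<^sup>2 * (N x - m)\<^sup>2 + 4 / m * R x" for x
  have count: "(\<Sum>k<n. indicator (A k - E k) x) = N x - R x" for x
    unfolding N_def R_def sum_subtractf[symmetric]
    by (intro sum.cong refl) (auto simp: indicator_def)
  have N_meas [measurable]: "N \<in> borel_measurable M" and [measurable]: "R \<in> borel_measurable M"
    unfolding N_def R_def by measurable
  have R_nonneg: "0 \<le> R x" for x
    unfolding R_def by (intro sum_nonneg) simp
  have N_bounds: "0 \<le> N x" "N x \<le> n" for x
  proof -
    show "0 \<le> N x" unfolding N_def by (intro sum_nonneg) simp
    have "N x \<le> (\<Sum>k<n. 1)" unfolding N_def by (intro sum_mono) (simp add: indicator_def)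
    then show "N x \<le> n" by simp
  qed
  have int_sq: "integrable M (\<lambda>x. (N x - m)\<^sup>2)"
  proof (rule integrable_const_bound[where B = "(n + m)\<^sup>2"])
    show "AE x in M. norm ((N x - m)\<^sup>2) \<le> (n + m)\<^sup>2"
    proof (rule AE_I2)
      fix x
      have "\<bar>N x - m\<bar> \<le> \<bar>n + m\<bar>" using N_bounds[of x] m(2) by auto
      then show "norm ((N x - m)\<^sup>2) \<le> (n + m)\<^sup>2" by (simp add: abs_le_square_iff)
    qed
  qed measurable
  have int_R: "integrable M R"
    unfolding R_def by (auto intro!: integrable_real_indicator simp: emeasure_eq_measure)
  have "expectation (\<lambda>x. (N x - m)\<^sup>2) \<le> m"
    using centred_count_second_moment[of A n] indep by (simp add: N_def m(1) sum_subtractf)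
  moreover have "expectation R = (\<Sum>k<n. prob (A k \<inter> E k))"
    unfolding R_def by (simp add: emeasure_eq_measure)
  ultimately have "expectation u \<le> 4 / m\<^sup>2 * m + 4 / m * (\<Sum>k<n. prob (A k \<inter> E k))"
    unfolding u_def using int_sq int_R m(2) by (simp add: divide_right_mono)
  then have Eu: "expectation u \<le> 4 / m + 4 * ((\<Sum>k<n. prob (A k \<inter> E k)) / m)"
    using m(2) by (simp add: power2_eq_square)
  have large: "1 \<le> u x" if "N x - R x \<le> K" for x
  proof (cases "N x \<le> m / 2")
    case True
    then have "(m / 2)\<^sup>2 \<le> (m - N x)\<^sup>2" using m(2) by (intro power_mono) auto
    then have "1 \<le> 4 / m\<^sup>2 * (N x - m)\<^sup>2"
      using m(2) by (simp add: field_simps power2_commute[of m])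
    then show ?thesis using R_nonneg[of x] m(2) by (simp add: u_def add_increasing2)
  next
    case False
    then have "m / 4 \<le> R x" using that m(3) by simp
    then have "1 \<le> 4 / m * R x" using m(2) by (simp add: field_simps)
    then show ?thesis by (simp add: u_def add_increasing)
  qed
  have "prob {x \<in> space M. (\<Sum>k<n. indicator (A k - E k) x) \<le> K} \<le> prob {x \<in> space M. u x \<ge> 1}"
    unfolding count using large by (intro finite_measure_mono) (auto simp: u_def)
  also have "\<dots> \<le> expectation u / 1"
  proof (rule integral_Markov_inequality_measure)
    show "integrable M u" unfolding u_def using int_sq int_R by auto
    show "AE x in M. 0 \<le> u x" unfolding u_def using R_nonneg m(2) by auto
    show "space M \<in> sets M" by simp
  qed simp
  finally show ?thesis using Eu by simp
qed

section \<open>Borel--Cantelli lemmas for differences of events\<close>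

text \<open>
  For a fixed bound \<open>K\<close>, the event that the total count of the \<open>A k - E k\<close> never exceeds \<open>K\<close> is
  contained in the corresponding event for each finite count, so that its probability is at
  most a quantity that vanishes as \<open>n\<close> grows.
\<close>

lemma AE_infinitely_often_Diff:
  fixes A E :: "nat \<Rightarrow> 'a set"
  assumes meas [measurable]: "\<And>k. A k \<in> events" "\<And>k. E k \<in> events"
    and indep: "\<And>i j. i \<noteq> j \<Longrightarrow> prob (A i \<inter> A j) = prob (A i) * prob (A j)"
    and div: "filterlim (\<lambda>n. \<Sum>k<n. prob (A k)) at_top sequentially"
    and small: "(\<lambda>n. (\<Sum>k<n. prob (A k \<inter> E k)) / (\<Sum>k<n. prob (A k))) \<longlonglongrightarrow> 0"
  shows "AE x in M. (\<Sum>n. indicator (A n - E n) x :: ennreal) = \<infinity>"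
proof -
  define m where "m n = (\<Sum>k<n. prob (A k))" for n
  have "AE x in M. \<exists>n. real K < (\<Sum>k<n. indicator (A k - E k) x)" for K :: nat
  proof -
    define Z where "Z = {x \<in> space M. \<forall>n. (\<Sum>k<n. indicator (A k - E k) x) \<le> real K}"
    have [measurable]: "Z \<in> events" unfolding Z_def by measurable
    have "(\<lambda>n. 4 / m n + 4 * ((\<Sum>k<n. prob (A k \<inter> E k)) / m n)) \<longlonglongrightarrow> 0 + 4 * 0"
      using div small unfolding m_def
      by (intro tendsto_intros tendsto_divide_0[OF tendsto_const] filterlim_at_top_imp_at_infinity)
    moreover have "\<forall>\<^sub>F n in sequentially. max 1 (4 * real K) \<le> m n"
      using div unfolding m_def filterlim_at_top by blast
    then have "\<forall>\<^sub>F n in sequentially. prob Z \<le> 4 / m n + 4 * ((\<Sum>k<n. prob (A k \<inter> E k)) / m n)"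
    proof eventually_elim
      case (elim n)
      have "prob Z \<le> prob {x \<in> space M. (\<Sum>k<n. indicator (A k - E k) x) \<le> real K}"
        unfolding Z_def by (intro finite_measure_mono) auto
      also have "\<dots> \<le> 4 / m n + 4 * ((\<Sum>k<n. prob (A k \<inter> E k)) / m n)"
        using elim by (intro prob_count_Diff_le meas indep m_def) auto
      finally show ?case .
    qed
    ultimately have "prob Z \<le> 0"
      using tendsto_lowerbound[of _ "0 + 4 * 0" sequentially "prob Z"] by simp
    then have "prob Z = 0" by (simp add: measure_le_0_iff)
    then have "AE x in M. x \<notin> Z" by (simp add: prob_eq_0)
    then show ?thesis
      by (auto elim!: AE_mp intro!: AE_I2 simp: Z_def not_le)
  qed
  then have "AE x in M. \<forall>K::nat. \<exists>n. real K < (\<Sum>k<n. indicator (A k - E k) x)"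
    by (simp add: AE_all_countable)
  then show ?thesis
    by eventually_elim (rule suminf_indicator_eq_top, blast)
qed

text \<open>
  Since \<open>P (A n - E n) = P (A n) * (1 - P (E n))\<close>, once \<open>P (E n) < 1 / 2\<close> the removal of \<open>E n\<close>
  costs at most half of the probability of \<open>A n\<close>.
\<close>

lemma summable_prob_if_summable_prob_Diff:
  fixes A E :: "nat \<Rightarrow> 'a set"
  assumes [measurable]: "\<And>k. A k \<in> events" "\<And>k. E k \<in> events"
    and indep: "\<And>n. prob (A n \<inter> E n) = prob (A n) * prob (E n)"
    and lim: "(\<lambda>n. prob (E n)) \<longlonglongrightarrow> 0"
    and summ: "summable (\<lambda>n. prob (A n - E n))"
  shows "summable (\<lambda>n. prob (A n))"
proof (rule summable_comparison_test_ev)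
  have "\<forall>\<^sub>F n in sequentially. prob (E n) < 1 / 2"
    by (intro order_tendstoD(2)[OF lim]) simp
  then show "\<forall>\<^sub>F n in sequentially. norm (prob (A n)) \<le> 2 * prob (A n - E n)"
  proof eventually_elim
    case (elim n)
    have "prob (A n - E n) = prob (A n) - prob (A n) * prob (E n)"
      by (simp add: finite_measure_Diff' indep)
    moreover have "prob (A n) * prob (E n) \<le> prob (A n) * (1 / 2)"
      using elim by (intro mult_left_mono) auto
    ultimately show ?case by simp
  qed
  show "summable (\<lambda>n. 2 * prob (A n - E n))"
    using summ by (rule summable_mult)
qed

end

theorem theorem1p1:
  fixes M :: "'a measure" and A E B :: "nat \<Rightarrow> 'a set"
  assumes "prob_space M"
    and "prob_space.indep_events M A UNIV"
    and "\<And>n. E n \<in> sets M"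
    and "\<And>n. prob_space.indep_event M (E n) (A n)"
    and "(\<lambda>n. measure M (E n)) \<longlonglongrightarrow> 0"
    and "\<And>n. B n = A n - E n"
  shows "((\<Sum>n. ennreal (measure M (B n))) < \<infinity> \<longrightarrow>
           (AE \<omega> in M. (\<Sum>n. indicator (A n) \<omega> :: ennreal) < \<infinity>)) \<and>
         ((\<Sum>n. ennreal (measure M (A n))) = \<infinity> \<longrightarrow>
           (AE \<omega> in M. (\<Sum>n. indicator (B n) \<omega> :: ennreal) = \<infinity>))"
proof -
  interpret prob_space M by fact
  have A [measurable]: "A k \<in> events" for k
    using assms(2) unfolding indep_events_def by auto
  note E = assms(3)
  have AE: "prob (A n \<inter> E n) = prob (A n) * prob (E n)" for n
    using indep_event_prob_Int[OF assms(4)[of n]] by (simp add: Int_commute mult.commute)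
  have AA: "prob (A i \<inter> A j) = prob (A i) * prob (A j)" if "i \<noteq> j" for i j
  proof -
    have "prob (\<Inter>k\<in>{i, j}. A k) = (\<Prod>k\<in>{i, j}. prob (A k))"
      using assms(2) unfolding indep_events_def by (metis finite.emptyI finite_insert insert_not_empty subset_UNIV)
    then show ?thesis using that by simp
  qed
  have B: "B = (\<lambda>n. A n - E n)" using assms(6) by auto
  show ?thesis
  proof (intro conjI impI)
    assume "(\<Sum>n. ennreal (prob (B n))) < \<infinity>"
    then have "summable (\<lambda>n. prob (A n - E n))"
      unfolding B by (intro summable_suminf_not_top) auto
    then have "summable (\<lambda>n. prob (A n))"
      by (intro summable_prob_if_summable_prob_Diff[of A E] A E AE assms(5))
    then have "AE x in M. \<forall>\<^sub>F n in sequentially. x \<in> space M - A n"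
      by (intro borel_cantelli_AE1 A) (simp_all add: emeasure_eq_measure)
    then show "AE x in M. (\<Sum>n. indicator (A n) x :: ennreal) < \<infinity>"
      by eventually_elim (rule suminf_indicator_less_top, auto elim: eventually_mono)
  next
    assume "(\<Sum>n. ennreal (prob (A n))) = \<infinity>"
    then have "\<not> summable (\<lambda>n. prob (A n))"
      using ennreal_suminf_neq_top[of "\<lambda>n. prob (A n)"] by auto
    then have div: "filterlim (\<lambda>n. \<Sum>k<n. prob (A k)) at_top sequentially"
      by (intro sum_filterlim_at_top_if_not_summable) auto
    have "(\<lambda>n. (\<Sum>k<n. prob (A k \<inter> E k)) / (\<Sum>k<n. prob (A k))) \<longlonglongrightarrow> 0"
      unfolding AE by (intro weighted_average_null_sequence div assms(5)) auto
    then show "AE x in M. (\<Sum>n. indicator (B n) x :: ennreal) = \<infinity>"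
      unfolding B by (intro AE_infinitely_often_Diff A E AA div)
  qed
qed

end
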